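(* Let $A=(a_{i,j})$ be an $r\times r$ symmetrizable generalized Cartan matrix and let $l\ge1$. For every $P\in M_{l,r}(\mathbb{Z})$, the map $$p:[1,r]\times\mathbb{Z}\longrightarrow\mathbb{Z}^l,\qquad(i,m)\longmapsto p(i,m),$$ where $p(i,m)$ is the $i$th column of $P_{t(i,m)}$, is a $\mathbb{Z}^l$-valued cluster additive function associated to $A$. Every $\mathbb{Z}^l$-valued cluster additive function associated to $A$ arises this way for a unique $P\in M_{l,r}(\mathbb{Z})$.
   Context: $[1,r]=\{1,\dots,r\}$; $[a]_+=\max(a,0)$, applied entrywise to vectors and matrices; $M_{l,r}(\mathbb{Z})$ is the set of $l\times r$ integer matrices. Symmetrizable generalized Cartan matrix: $a_{i,i}=2$, $a_{i,j}\in\mathbb{Z}_{\le0}$ for $i\ne j$, $a_{i,j}=0$ iff $a_{j,i}=0$, and $DA$ is symmetric for some diagonal $D$ with positive integer diagonal entries. $B_A$ is the $r\times r$ matrix with $(i,j)$ entry $-a_{i,j}$ if $i<j$, $0$ if $i=j$, $a_{i,j}$ if $i>j$. For an $(r+l)\times r$ integer matrix $\widetilde B=(b_{i,j})$ with skew-symmetrizable top $r\times r$ part and $k\in[1,r]$, $\mu_k(\widetilde B)=(b'_{i,j})$ with $b'_{i,j}=-b_{i,j}$ if $i=k$ or $j=k$, and $b'_{i,j}=b_{i,j}+[b_{i,k}]_+[b_{k,j}]_+-[-b_{i,k}]_+[-b_{k,j}]_+$ otherwise; $\mu_k$ is an involution. Given $P\in M_{l,r}(\mathbb{Z})$, define matrices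 $\widetilde B_{t(i,m)}=\binom{B_{t(i,m)}}{P_{t(i,m)}}$, $(i,m)\in[1,r]\times\mathbb{Z}$ (with $B_{t(i,m)}$ of size $r\times r$), by $\widetilde B_{t(1,0)}=\binom{B_A}{P}$, $\widetilde B_{t(i+1,m)}=\mu_i(\widetilde B_{t(i,m)})$ for $i\in[1,r-1]$, and $\widetilde B_{t(1,m+1)}=\mu_r(\widetilde B_{t(r,m)})$, for all $m\in\mathbb{Z}$. A $\mathbb{Z}^l$-valued cluster additive function associated to $A$ is a map $q:[1,r]\times\mathbb{Z}\to\mathbb{Z}^l$ with $$q(i,m)+q(i,m+1)=\sum_{j=i+1}^r(-a_{j,i})[q(j,m)]_++\sum_{j=1}^{i-1}(-a_{j,i})[q(j,m+1)]_+,\qquad(i,m)\in[1,r]\times\mathbb{Z}.$$ *)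

theory Defs
  imports "Jordan_Normal_Form.Matrix"
begin

text \<open>
  All row, column and vector indices start at 0, as usual for \<^typ>\<open>'a mat\<close>, so the index set
  $[1,r]$ is represented by \<open>{0..<r}\<close>, with the same order. The integer \<open>m\<close> in a pair \<open>(i,m)\<close> is not
  shifted; in particular the pair $(1,0)$ becomes \<open>(0,0)\<close>.
\<close>

definition sym_gen_cartan :: "nat \<Rightarrow> int mat \<Rightarrow> bool" where
  "sym_gen_cartan r A \<longleftrightarrow>
     A \<in> carrier_mat r r \<and>
     (\<forall>i<r. A $$ (i, i) = 2) \<and>
     (\<forall>i<r. \<forall>j<r. i \<noteq> j \<longrightarrow> A $$ (i, j) \<le> 0) \<and>
     (\<forall>i<r. \<forall>j<r. A $$ (i, j) = 0 \<longleftrightarrow> A $$ (j, i) = 0) \<and>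
     (\<exists>D \<in> carrier_mat r r. diagonal_mat D \<and> (\<forall>i<r. D $$ (i, i) > 0) \<and>
        transpose_mat (D * A) = D * A)"

definition B_mat :: "int mat \<Rightarrow> int mat" where
  "B_mat A = mat (dim_row A) (dim_col A)
     (\<lambda>(i, j). if i < j then - A $$ (i, j) else if i = j then 0 else A $$ (i, j))"

definition pos_int :: "int \<Rightarrow> int" where
  "pos_int a = max a 0"

definition mutate :: "nat \<Rightarrow> int mat \<Rightarrow> int mat" where
  "mutate k B = mat (dim_row B) (dim_col B)
     (\<lambda>(i, j). if i = k \<or> j = k then - B $$ (i, j)
       else B $$ (i, j) + pos_int (B $$ (i, k)) * pos_int (B $$ (k, j))
                        - pos_int (- B $$ (i, k)) * pos_int (- B $$ (k, j)))"

text \<open>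
  \<open>fold mutate [0..<i]\<close> mutates first at \<open>0\<close>, then at \<open>1\<close>, and so on up to \<open>i - 1\<close>. Since
  mutations are involutions, mutating in the order \<open>r - 1, \<dots>, 0\<close> undoes one full round, which
  gives the matrices with negative \<open>m\<close>. The lemmas \<open>B_tilde_start\<close>, \<open>B_tilde_step\<close>,
  \<open>B_tilde_wrap\<close> and \<open>B_tilde_unique\<close> below show that \<open>B_tilde A P\<close> is the only family
  satisfying the two-sided recursion over \<open>(i,m)\<close>.
\<close>

definition B_tilde :: "int mat \<Rightarrow> int mat \<Rightarrow> nat \<Rightarrow> int \<Rightarrow> int mat" where
  "B_tilde A P i m =
     (let r = dim_row A; B0 = B_mat A @\<^sub>r P in
      fold mutate [0..<i]
        (if m \<ge> 0 then (fold mutate [0..<r] ^^ nat m) B0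
         else (fold mutate (rev [0..<r]) ^^ nat (- m)) B0))"

definition lower_block :: "nat \<Rightarrow> int mat \<Rightarrow> int mat" where
  "lower_block r M = mat (dim_row M - r) (dim_col M) (\<lambda>(i, j). M $$ (r + i, j))"

definition P_mat :: "int mat \<Rightarrow> int mat \<Rightarrow> nat \<Rightarrow> int \<Rightarrow> int mat" where
  "P_mat A P i m = lower_block (dim_row A) (B_tilde A P i m)"

text \<open>
  A map on $[1,r] \times \mathbb{Z}$ is given by a total function \<open>q\<close> of which only the values
  \<open>q i m\<close> with \<open>i < r\<close> matter.
\<close>

definition cluster_additive :: "nat \<Rightarrow> nat \<Rightarrow> int mat \<Rightarrow> (nat \<Rightarrow> int \<Rightarrow> int vec) \<Rightarrow> bool" where
  "cluster_additive r l A q \<longleftrightarrow>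
     (\<forall>i<r. \<forall>m. q i m \<in> carrier_vec l) \<and>
     (\<forall>i<r. \<forall>m. q i m + q i (m + 1) =
        finsum_vec TYPE(int) l (\<lambda>j. (- A $$ (j, i)) \<cdot>\<^sub>v map_vec pos_int (q j m)) {i+1..<r} +
        finsum_vec TYPE(int) l (\<lambda>j. (- A $$ (j, i)) \<cdot>\<^sub>v map_vec pos_int (q j (m + 1))) {0..<i})"

lemma mutate_dim [simp]:
  "dim_row (mutate k B) = dim_row B" "dim_col (mutate k B) = dim_col B"
  unfolding mutate_def by (rule dim_row_mat dim_col_mat)+

lemma mutate_carrier [simp]: "mutate k B \<in> carrier_mat n c \<longleftrightarrow> B \<in> carrier_mat n c"
  unfolding carrier_mat_def mem_Collect_eq mutate_dim ..

lemma mutate_mutate: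
  assumes "k < dim_row B" "k < dim_col B"
  shows "mutate k (mutate k B) = B"
proof (rule eq_matI)
  fix i j assume ij: "i < dim_row B" "j < dim_col B"
  show "mutate k (mutate k B) $$ (i, j) = B $$ (i, j)"
  proof (cases "i = k \<or> j = k")
    case True
    then show ?thesis using ij by (simp add: mutate_def)
  next
    case False
    then show ?thesis using ij assms by (simp add: mutate_def)
  qed
qed simp_all

lemma fold_mutate_carrier [simp]:
  "fold mutate ks B \<in> carrier_mat n c \<longleftrightarrow> B \<in> carrier_mat n c"
  by (induction ks arbitrary: B) auto

lemma fold_mutate_pow_carrier [simp]:
  "(fold mutate ks ^^ k) B \<in> carrier_mat n c \<longleftrightarrow> B \<in> carrier_mat n c"
  by (induction k) auto

lemma fold_mutate_rev:
  assumes "B \<in> carrier_mat n r" "r \<le> n" "set ks \<subseteq> {0..<r}"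
  shows "fold mutate ks (fold mutate (rev ks) B) = B"
  using assms(3)
proof (induction ks)
  case (Cons k ks)
  have "fold mutate (rev ks) B \<in> carrier_mat n r" using assms(1) by simp
  then have "mutate k (mutate k (fold mutate (rev ks) B)) = fold mutate (rev ks) B"
    using Cons.prems assms(2) by (intro mutate_mutate) auto
  then show ?case using Cons by simp
qed simp

lemma B_tilde_carrier:
  assumes "A \<in> carrier_mat r r" "P \<in> carrier_mat l r"
  shows "B_tilde A P i m \<in> carrier_mat (r + l) r"
proof -
  have "B_mat A @\<^sub>r P \<in> carrier_mat (r + l) r"
    using assms by (intro carrier_append_rows) (auto simp: B_mat_def)
  then show ?thesis by (simp add: B_tilde_def Let_def)
qed

lemma B_tilde_start: "B_tilde A P 0 0 = B_mat A @\<^sub>r P"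
  by (simp add: B_tilde_def)

lemma B_tilde_step: "B_tilde A P (Suc i) m = mutate i (B_tilde A P i m)"
  by (simp add: B_tilde_def Let_def)

lemma B_tilde_wrap:
  assumes A: "A \<in> carrier_mat r r" and P: "P \<in> carrier_mat l r" and r: "1 \<le> r"
  shows "B_tilde A P 0 (m + 1) = mutate (r - 1) (B_tilde A P (r - 1) m)"
proof -
  define B0 where "B0 = B_mat A @\<^sub>r P"
  have B0: "B0 \<in> carrier_mat (r + l) r"
    using B_tilde_carrier[OF A P, of 0 0] by (simp add: B0_def B_tilde_start)
  have dim: "dim_row A = r" using A by simp
  have "mutate (r - 1) (B_tilde A P (r - 1) m) = B_tilde A P r m"
    using B_tilde_step[of A P "r - 1" m] r by simp
  also have "\<dots> = B_tilde A P 0 (m + 1)"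
  proof (cases "m \<ge> 0")
    case True
    then have "nat (m + 1) = Suc (nat m)" by simp
    then show ?thesis using True by (simp add: B_tilde_def dim Let_def)
  next
    case False
    define k where "k = nat (- (m + 1))"
    have k: "nat (- m) = Suc k" using False by (simp add: k_def)
    have "fold mutate [0..<r] (fold mutate (rev [0..<r])
            ((fold mutate (rev [0..<r]) ^^ k) B0)) = (fold mutate (rev [0..<r]) ^^ k) B0"
      using B0 by (intro fold_mutate_rev[where n = "r + l" and r = r]) auto
    then have "B_tilde A P r m = (fold mutate (rev [0..<r]) ^^ k) B0"
      using False k by (simp add: B_tilde_def dim Let_def B0_def)
    also have "\<dots> = B_tilde A P 0 (m + 1)"
    proof (cases "m + 1 = 0")
      case True
      then show ?thesis by (simp add: B_tilde_def k_def B0_def)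
    next
      case neq: False
      then show ?thesis using False
        by (simp add: B_tilde_def dim Let_def k_def B0_def)
    qed
    finally show ?thesis .
  qed
  finally show ?thesis by simp
qed

lemma B_tilde_unique:
  assumes A: "A \<in> carrier_mat r r" and P: "P \<in> carrier_mat l r"
    and T: "\<And>i m. i < r \<Longrightarrow> T i m \<in> carrier_mat (r + l) r"
    and start: "T 0 0 = B_mat A @\<^sub>r P"
    and step: "\<And>i m. Suc i < r \<Longrightarrow> T (Suc i) m = mutate i (T i m)"
    and wrap: "\<And>m. T 0 (m + 1) = mutate (r - 1) (T (r - 1) m)"
    and i: "i < r"
  shows "T i m = B_tilde A P i m"
proof -
  have r: "1 \<le> r" using i by simp
  have up: "T j n = B_tilde A P j n" if "T 0 n = B_tilde A P 0 n" "j < r" for j n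
    using that(2) by (induction j) (auto simp: that(1) step B_tilde_step)
  have inj: "X = Y" if "mutate k X = mutate k Y" "k < r"
      "X \<in> carrier_mat (r + l) r" "Y \<in> carrier_mat (r + l) r" for k X Y
  proof -
    have "X = mutate k (mutate k X)" using that(2,3) by (intro mutate_mutate[symmetric]) auto
    also have "\<dots> = mutate k (mutate k Y)" by (simp only: that(1))
    also have "\<dots> = Y" using that(2,4) by (intro mutate_mutate) auto
    finally show ?thesis .
  qed
  have down: "T 0 n = B_tilde A P 0 n" if eq: "T 0 (n + 1) = B_tilde A P 0 (n + 1)" for n
  proof -
    have last: "T (r - 1) n = B_tilde A P (r - 1) n"
    proof (rule inj[where k = "r - 1"])
      show "mutate (r - 1) (T (r - 1) n) = mutate (r - 1) (B_tilde A P (r - 1) n)"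
        using eq unfolding wrap B_tilde_wrap[OF A P r] .
    qed (use r in \<open>simp_all add: T B_tilde_carrier[OF A P]\<close>)
    have "T (r - 1 - j) n = B_tilde A P (r - 1 - j) n" if "j < r" for j
      using that
    proof (induction j)
      case (Suc j)
      have s: "Suc (r - 1 - Suc j) = r - 1 - j" using Suc.prems by simp
      show ?case
      proof (rule inj[where k = "r - 1 - Suc j"])
        have "T (r - 1 - j) n = B_tilde A P (r - 1 - j) n"
          using Suc by simp
        then show "mutate (r - 1 - Suc j) (T (r - 1 - Suc j) n)
            = mutate (r - 1 - Suc j) (B_tilde A P (r - 1 - Suc j) n)"
          using step[of "r - 1 - Suc j" n] B_tilde_step[of A P "r - 1 - Suc j" n] 
          unfolding s using r by simp
      qed (use r in \<open>simp_all add: T B_tilde_carrier[OF A P]\<close>)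
    qed (use last in simp)
    from this[of "r - 1"] show ?thesis using r by simp
  qed
  have "T 0 m = B_tilde A P 0 m"
  proof (induction m rule: int_induct[where k = 0])
    case base
    show ?case by (simp add: start B_tilde_start)
  next
    case (step1 n)
    have "T (r - 1) n = B_tilde A P (r - 1) n" 
      by (rule up[OF step1(2)]) (use r in simp)
    then show ?case by (simp only: wrap B_tilde_wrap[OF A P r])
  next
    case (step2 n)
    show ?case by (rule down) (simp add: step2)
  qed
  then show ?thesis using up i by blast
qed

end

theory Submission
  imports Defs
begin

text \<open>
  In the top block of $\widetilde B_{t(i,m)}$ the row \<open>i\<close> is nonnegative and the column \<open>i\<close> is
  nonpositive, so each mutation of the sequence only flips the signs of a row and a column of the
  top block. The mutation at \<open>k\<close> then acts on the bottom rows by $c_k \mapsto -c_k$ and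
  $c_j \mapsto c_j + (-a_{k,j})[c_k]_+$. Following column \<open>j\<close> through the round from
  $t(j,m)$ to $t(j,m+1)$ adds up to the cluster additive relation. Conversely that relation
  determines \<open>q\<close> from its values at $m = 0$, and these are related to the columns of \<open>P\<close> by a
  unitriangular change of variables.
\<close>

section \<open>Sign pattern of the top block along the mutation sequence\<close>

text \<open>The bound \<open>i\<close> separates the indices already mutated in the current round
  from the others: exactly the entries joining the two groups carry a changed sign. \<open>M\<close>
  may have further rows below the top block, which are left unconstrained.\<close>

definition acyclic_top :: "int mat \<Rightarrow> nat \<Rightarrow> int mat \<Rightarrow> bool" where
  "acyclic_top A i M \<longleftrightarrow>
     (\<forall>a < dim_row A. \<forall>b < dim_row A.
        M $$ (a, b) = (if (a < i) = (b < i) then B_mat A $$ (a, b) else - B_mat A $$ (a, b)))"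

lemma sym_gen_cartanD:
  assumes "sym_gen_cartan r A"
  shows "A \<in> carrier_mat r r"
    and "\<And>i j. i < r \<Longrightarrow> j < r \<Longrightarrow> i \<noteq> j \<Longrightarrow> A $$ (i, j) \<le> 0"
  using assms by (auto simp: sym_gen_cartan_def)

lemma B_mat_index:
  assumes "A \<in> carrier_mat r r" "i < r" "j < r"
  shows "B_mat A $$ (i, j) = (if i < j then - A $$ (i, j) else if i = j then 0 else A $$ (i, j))"
  using assms by (simp add: B_mat_def)

lemma mutate_index:
  assumes "M \<in> carrier_mat n c" "i < n" "j < c"
  shows "mutate k M $$ (i, j) = (if i = k \<or> j = k then - M $$ (i, j)
       else M $$ (i, j) + pos_int (M $$ (i, k)) * pos_int (M $$ (k, j))
                        - pos_int (- M $$ (i, k)) * pos_int (- M $$ (k, j)))"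
  using assms by (simp add: mutate_def)

text \<open>At this stage column \<open>k\<close> is nonpositive and row \<open>k\<close>
  nonnegative, so both products in the mutation rule vanish on the top block and only signs in row
  and column \<open>k\<close> change.\<close>

lemma acyclic_top_mutate:
  assumes A: "sym_gen_cartan r A" and M: "M \<in> carrier_mat (r + l) r" and k: "k < r"
    and top: "acyclic_top A k M"
  shows "acyclic_top A (Suc k) (mutate k M)"
  unfolding acyclic_top_def
proof (intro allI impI)
  fix a b assume "a < dim_row A" "b < dim_row A"
  then have ab: "a < r" "b < r" using sym_gen_cartanD(1)[OF A] by auto
  have ent: "M $$ (a', b') = (if (a' < k) = (b' < k) then B_mat A $$ (a', b') else - B_mat A $$ (a', b'))"
    if "a' < r" "b' < r" for a' b'
    using top that sym_gen_cartanD(1)[OF A] by (auto simp: acyclic_top_def)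
  have col: "pos_int (M $$ (a, k)) = 0"
    using ent[OF ab(1) k] sym_gen_cartanD(2)[OF A ab(1) k]
    by (auto simp: B_mat_index[OF sym_gen_cartanD(1)[OF A] ab(1) k] pos_int_def max_def)
  have row: "pos_int (- M $$ (k, b)) = 0"
    using ent[OF k ab(2)] sym_gen_cartanD(2)[OF A k ab(2)]
    by (auto simp: B_mat_index[OF sym_gen_cartanD(1)[OF A] k ab(2)] pos_int_def max_def)
  \<comment> \<open>Mutation negates the entry \<open>(k, k)\<close>, whose two indices always lie
    in the same group; the pattern survives because this entry is zero.\<close>
  have diag: "B_mat A $$ (k, k) = 0"
    using B_mat_index[OF sym_gen_cartanD(1)[OF A] k k] by simp
  show "mutate k M $$ (a, b) = (if (a < Suc k) = (b < Suc k) then B_mat A $$ (a, b) else - B_mat A $$ (a, b))"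
    using ab ent[OF ab] diag by (auto simp: mutate_index[OF M] row col less_Suc_eq)
qed

text \<open>This serves negative \<open>m\<close>, reached by mutating backwards. Now column
  \<open>k\<close> is nonnegative and row \<open>k\<close> nonpositive, and the products vanish
  again.\<close>

lemma acyclic_top_mutate_inverse:
  assumes A: "sym_gen_cartan r A" and M: "M \<in> carrier_mat (r + l) r" and k: "k < r"
    and top: "acyclic_top A (Suc k) M"
  shows "acyclic_top A k (mutate k M)"
  unfolding acyclic_top_def
proof (intro allI impI)
  fix a b assume "a < dim_row A" "b < dim_row A"
  then have ab: "a < r" "b < r" using sym_gen_cartanD(1)[OF A] by auto
  have ent: "M $$ (a', b') = (if (a' < Suc k) = (b' < Suc k) then B_mat A $$ (a', b') else - B_mat A $$ (a', b'))"
    if "a' < r" "b' < r" for a' b'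
    using top that sym_gen_cartanD(1)[OF A] by (auto simp: acyclic_top_def)
  have col: "pos_int (- M $$ (a, k)) = 0"
    using ent[OF ab(1) k] sym_gen_cartanD(2)[OF A ab(1) k]
    by (auto simp: B_mat_index[OF sym_gen_cartanD(1)[OF A] ab(1) k] pos_int_def max_def)
  have row: "pos_int (M $$ (k, b)) = 0"
    using ent[OF k ab(2)] sym_gen_cartanD(2)[OF A k ab(2)]
    by (auto simp: B_mat_index[OF sym_gen_cartanD(1)[OF A] k ab(2)] pos_int_def max_def)
  have diag: "B_mat A $$ (k, k) = 0"
    using B_mat_index[OF sym_gen_cartanD(1)[OF A] k k] by simp
  show "mutate k M $$ (a, b) = (if (a < k) = (b < k) then B_mat A $$ (a, b) else - B_mat A $$ (a, b))"
    using ab ent[OF ab] diag by (auto simp: mutate_index[OF M] row col less_Suc_eq)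
qed

text \<open>With all indices mutated, or none, no entry joins the two groups, so a full round
  restores the starting pattern.\<close>

lemma acyclic_top_full:
  assumes "sym_gen_cartan r A"
  shows "acyclic_top A r M \<longleftrightarrow> acyclic_top A 0 M"
  using sym_gen_cartanD(1)[OF assms] by (auto simp: acyclic_top_def)

lemma acyclic_top_fold:
  assumes A: "sym_gen_cartan r A" and M: "M \<in> carrier_mat (r + l) r" and "i \<le> r"
    and "acyclic_top A 0 M"
  shows "acyclic_top A i (fold mutate [0..<i] M)"
  using assms(3)
proof (induction i)
  case (Suc i)
  then show ?case
    using acyclic_top_mutate[OF A, of "fold mutate [0..<i] M" l i] M by simp
qed (use assms(4) in simp)

lemma acyclic_top_fold_rev:
  assumes A: "sym_gen_cartan r A" and "M \<in> carrier_mat (r + l) r" and "i \<le> r"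
    and "acyclic_top A i M"
  shows "acyclic_top A 0 (fold mutate (rev [0..<i]) M)"
  using assms(2-)
\<comment> \<open>\<open>rev [0..<Suc i]\<close> mutates at \<open>i\<close> first, so the induction
  hypothesis is applied to \<open>mutate i M\<close>.\<close>
proof (induction i arbitrary: M)
  case (Suc i)
  then show ?case
    using acyclic_top_mutate_inverse[OF A, of M l i] by simp
qed simp

lemma acyclic_top_B_tilde:
  assumes A: "sym_gen_cartan r A" and P: "P \<in> carrier_mat l r" and i: "i \<le> r"
  shows "acyclic_top A i (B_tilde A P i m)"
proof -
  note cA = sym_gen_cartanD(1)[OF A]
  define B0 where "B0 = B_mat A @\<^sub>r P"
  have B0: "B0 \<in> carrier_mat (r + l) r"
    using B_tilde_carrier[OF cA P, of 0 0] by (simp add: B0_def B_tilde_start)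
  have top0: "acyclic_top A 0 B0"
    using cA P by (auto simp: acyclic_top_def B0_def append_rows_def B_mat_def)
  have up: "acyclic_top A 0 ((fold mutate [0..<r] ^^ n) B0)" for n
  proof (induction n)
    case (Suc n)
    then show ?case
      using acyclic_top_fold[OF A, of "(fold mutate [0..<r] ^^ n) B0" l r] B0
      by (simp add: acyclic_top_full[OF A])
  qed (simp add: top0)
  have down: "acyclic_top A 0 ((fold mutate (rev [0..<r]) ^^ n) B0)" for n
  proof (induction n)
    case (Suc n)
    then show ?case
      using acyclic_top_fold_rev[OF A, of "(fold mutate (rev [0..<r]) ^^ n) B0" l r] B0
      by (simp add: acyclic_top_full[OF A])
  qed (simp add: top0)
  have "dim_row A = r" using cA by simp
  then show ?thesis
    using acyclic_top_fold[OF A _ i, of _ l] B0 up down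
    by (simp add: B_tilde_def Let_def B0_def)
qed

section \<open>Evolution of the bottom rows\<close>

lemma B_tilde_Suc_bottom:
  assumes A: "sym_gen_cartan r A" and P: "P \<in> carrier_mat l r"
    and k: "k < r" and x: "x < l" and j: "j < r"
  shows "B_tilde A P (Suc k) m $$ (r + x, j) =
    (if j = k then - B_tilde A P k m $$ (r + x, k)
     else B_tilde A P k m $$ (r + x, j)
       + (- A $$ (k, j)) * pos_int (B_tilde A P k m $$ (r + x, k)))"
proof -
  note cA = sym_gen_cartanD(1)[OF A]
  note M = B_tilde_carrier[OF cA P, of k m]
  \<comment> \<open>For \<open>k < j\<close> this is an entry of \<open>B_mat A\<close> above the
    diagonal, for \<open>j < k\<close> one below the diagonal with changed sign. Being nonnegative
    in both cases, it leaves only the product of positive parts.\<close>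
  have "B_tilde A P k m $$ (k, j) = - A $$ (k, j)" if "j \<noteq> k"
    using acyclic_top_B_tilde[OF A P, of k m] k j that cA
    by (auto simp: acyclic_top_def B_mat_index[OF cA])
  moreover have "A $$ (k, j) \<le> 0" if "j \<noteq> k"
    using sym_gen_cartanD(2)[OF A k j] that by simp
  ultimately show ?thesis
    using x j k by (auto simp: B_tilde_step mutate_index[OF M] pos_int_def max_def)
qed

lemma B_tilde_bottom_before:
  assumes A: "sym_gen_cartan r A" and P: "P \<in> carrier_mat l r"
    and x: "x < l" and j: "j < r" and i: "i \<le> j"
  shows "B_tilde A P i m $$ (r + x, j) = B_tilde A P 0 m $$ (r + x, j)
    + (\<Sum>k\<in>{0..<i}. (- A $$ (k, j)) * pos_int (B_tilde A P k m $$ (r + x, k)))"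
  using i
proof (induction i)
  case (Suc i)
  then show ?case
    using B_tilde_Suc_bottom[OF A P _ x j, of i m] j by simp
qed simp

text \<open>The mutation at \<open>j\<close> negates the entry, and each later mutation of the round
  adds its term to the negated value.\<close>

lemma B_tilde_bottom_after:
  assumes A: "sym_gen_cartan r A" and P: "P \<in> carrier_mat l r"
    and x: "x < l" and j: "j < i" and i: "i \<le> r"
  shows "B_tilde A P i m $$ (r + x, j) = - B_tilde A P j m $$ (r + x, j)
    + (\<Sum>k\<in>{j+1..<i}. (- A $$ (k, j)) * pos_int (B_tilde A P k m $$ (r + x, k)))"
  using j i
proof (induction i)
  case (Suc i)
  then show ?case
    using B_tilde_Suc_bottom[OF A P _ x, of i j m] by (cases "j = i") auto
qed simp

text \<open>Round \<open>m\<close> from the mutation at \<open>j\<close> on gives the sign change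
  and the first sum; round \<open>m + 1\<close> before the mutation at \<open>j\<close> gives the
  second. The two stretches meet at the start of round \<open>m + 1\<close>.\<close>

lemma B_tilde_bottom_recurrence:
  assumes A: "sym_gen_cartan r A" and P: "P \<in> carrier_mat l r"
    and x: "x < l" and j: "j < r"
  shows "B_tilde A P j m $$ (r + x, j) + B_tilde A P j (m + 1) $$ (r + x, j) =
    (\<Sum>k\<in>{j+1..<r}. (- A $$ (k, j)) * pos_int (B_tilde A P k m $$ (r + x, k))) +
    (\<Sum>k\<in>{0..<j}. (- A $$ (k, j)) * pos_int (B_tilde A P k (m + 1) $$ (r + x, k)))"
proof -
  have "B_tilde A P 0 (m + 1) = B_tilde A P r m"
    using B_tilde_wrap[OF sym_gen_cartanD(1)[OF A] P, of m] B_tilde_step[of A P "r - 1" m] j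
    by simp
  then show ?thesis
    using B_tilde_bottom_before[OF A P x j order_refl, of "m + 1"]
      B_tilde_bottom_after[OF A P x j order_refl, of m] by simp
qed

section \<open>Uniqueness of cluster additive functions with given initial values\<close>

text \<open>Since \<open>pos_int\<close> acts entrywise, the \<open>l\<close> coordinates do not
  interact and can be treated one at a time.\<close>

lemma cluster_additive_iff:
  assumes "A \<in> carrier_mat r r"
  shows "cluster_additive r l A q \<longleftrightarrow>
    (\<forall>i<r. \<forall>m. q i m \<in> carrier_vec l) \<and>
    (\<forall>i<r. \<forall>m. \<forall>x<l. q i m $ x + q i (m + 1) $ x =
       (\<Sum>j\<in>{i+1..<r}. (- A $$ (j, i)) * pos_int (q j m $ x)) +
       (\<Sum>j\<in>{0..<i}. (- A $$ (j, i)) * pos_int (q j (m + 1) $ x)))"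
proof (cases "\<forall>i<r. \<forall>m. q i m \<in> carrier_vec l")
  case True
  have "q i m + q i (m + 1) =
        finsum_vec TYPE(int) l (\<lambda>j. (- A $$ (j, i)) \<cdot>\<^sub>v map_vec pos_int (q j m)) {i+1..<r} +
        finsum_vec TYPE(int) l (\<lambda>j. (- A $$ (j, i)) \<cdot>\<^sub>v map_vec pos_int (q j (m + 1))) {0..<i}
      \<longleftrightarrow> (\<forall>x<l. q i m $ x + q i (m + 1) $ x =
       (\<Sum>j\<in>{i+1..<r}. (- A $$ (j, i)) * pos_int (q j m $ x)) +
       (\<Sum>j\<in>{0..<i}. (- A $$ (j, i)) * pos_int (q j (m + 1) $ x)))"
    (is "?L = ?S + ?T \<longleftrightarrow> ?R") if i: "i < r" for i m
  proof -
    have f: "(\<lambda>j. (- A $$ (j, i)) \<cdot>\<^sub>v map_vec pos_int (q j n)) \<in> J \<rightarrow> carrier_vec l"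
      if "J \<subseteq> {0..<r}" for J n
      using True that by auto
    have carr: "?S \<in> carrier_vec l" "?T \<in> carrier_vec l" "?L \<in> carrier_vec l"
      using True i by (auto intro!: finsum_vec_closed f)
    have sums: "?S $ x = (\<Sum>j\<in>{i+1..<r}. (- A $$ (j, i)) * pos_int (q j m $ x))"
      "?T $ x = (\<Sum>j\<in>{0..<i}. (- A $$ (j, i)) * pos_int (q j (m + 1) $ x))"
      "?L $ x = q i m $ x + q i (m + 1) $ x" if x: "x < l" for x
    proof -
      have c: "q j n \<in> carrier_vec l" if "j < r" for j n using True that by blast
      show "?S $ x = (\<Sum>j\<in>{i+1..<r}. (- A $$ (j, i)) * pos_int (q j m $ x))"
        by (subst index_finsum_vec[OF _ x f])
          (use x in \<open>auto intro!: sum.cong simp: carrier_vecD[OF c]\<close>)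
      show "?T $ x = (\<Sum>j\<in>{0..<i}. (- A $$ (j, i)) * pos_int (q j (m + 1) $ x))"
        by (subst index_finsum_vec[OF _ x f])
          (use x i in \<open>auto intro!: sum.cong simp: carrier_vecD[OF c]\<close>)
      show "?L $ x = q i m $ x + q i (m + 1) $ x"
        using x carrier_vecD[OF c[OF i]] by simp
    qed
    have "(?S + ?T) $ x = ?S $ x + ?T $ x" if "x < l" for x
      using that carrier_vecD[OF carr(1)] carrier_vecD[OF carr(2)] by simp
    then show ?thesis
      unfolding vec_eq_iff using carrier_vecD[OF carr(1)] carrier_vecD[OF carr(2)]
        carrier_vecD[OF carr(3)] sums by auto
  qed
  then show ?thesis using True by (simp add: cluster_additive_def)
qed (auto simp: cluster_additive_def)

lemma cluster_additive_eqI: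
  assumes A: "A \<in> carrier_mat r r"
    and q: "cluster_additive r l A q" and q': "cluster_additive r l A q'"
    and eq: "\<And>i. i < r \<Longrightarrow> q i 0 = q' i 0" and i: "i < r"
  shows "q i m = q' i m"
proof -
  have vecI: "q i m = q' i m" if "i < r" "\<And>x. x < l \<Longrightarrow> q i m $ x = q' i m $ x" for i m
  proof -
    have "q i m \<in> carrier_vec l" "q' i m \<in> carrier_vec l"
      using q q' that(1) by (simp_all add: cluster_additive_def)
    then show ?thesis using that(2) by (intro eq_vecI) auto
  qed
  have rec: "q i m $ x + q i (m + 1) $ x =
       (\<Sum>j\<in>{i+1..<r}. (- A $$ (j, i)) * pos_int (q j m $ x)) +
       (\<Sum>j\<in>{0..<i}. (- A $$ (j, i)) * pos_int (q j (m + 1) $ x))"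
    "q' i m $ x + q' i (m + 1) $ x =
       (\<Sum>j\<in>{i+1..<r}. (- A $$ (j, i)) * pos_int (q' j m $ x)) +
       (\<Sum>j\<in>{0..<i}. (- A $$ (j, i)) * pos_int (q' j (m + 1) $ x))"
    if "i < r" "x < l" for i m x
    using q q' that unfolding cluster_additive_iff[OF A] by blast+
  have "\<forall>i<r. q i m = q' i m"
  proof (induction m rule: int_induct[where k = 0])
    case base
    then show ?case using eq by simp
  next
    case (step1 m)
    \<comment> \<open>The unknown level \<open>m + 1\<close> enters the right side only with indices
      below \<open>i\<close>, so its values are determined in increasing order of
      \<open>i\<close>.\<close>
    have "i < r \<longrightarrow> q i (m + 1) = q' i (m + 1)" for i
    proof (induction i rule: less_induct)
      case (less i)
      show ?case
      proof (intro impI vecI)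
        fix x assume i: "i < r" and x: "x < l"
        have "q i m $ x + q i (m + 1) $ x = q' i m $ x + q' i (m + 1) $ x"
          unfolding rec[OF i x] using step1(2) less i by simp
        then show "q i (m + 1) $ x = q' i (m + 1) $ x" using step1(2) i by simp
      qed
    qed
    then show ?case by blast
  next
    case (step2 m)
    \<comment> \<open>Going backwards, the unknown level \<open>m - 1\<close> enters the right side
      only with indices above \<open>i\<close>, so the order is reversed.\<close>
    have "i < r \<longrightarrow> q i (m - 1) = q' i (m - 1)" for i
    proof (induction "r - i" arbitrary: i rule: less_induct)
      case less
      show ?case
      proof (intro impI vecI)
        fix x assume i: "i < r" and x: "x < l"
        have "q j (m - 1) = q' j (m - 1)" if "i < j" "j < r" for j
          using less[of j] that by simp
        then have "q i (m - 1) $ x + q i m $ x = q' i (m - 1) $ x + q' i m $ x"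
          using rec[OF i x, of "m - 1"] step2(2) i by simp
        then show "q i (m - 1) $ x = q' i (m - 1) $ x" using step2(2) i by simp
      qed
    qed
    then show ?case by blast
  qed
  then show ?thesis using i by blast
qed

section \<open>Correspondence between matrices and cluster additive functions\<close>

lemma col_P_mat:
  assumes "A \<in> carrier_mat r r" "P \<in> carrier_mat l r" "i < r"
  shows "col (P_mat A P i m) i \<in> carrier_vec l"
    and "x < l \<Longrightarrow> col (P_mat A P i m) i $ x = B_tilde A P i m $$ (r + x, i)"
  using assms B_tilde_carrier[OF assms(1,2), of i m]
  by (auto simp: P_mat_def lower_block_def)

lemma cluster_additive_P_mat:
  assumes A: "sym_gen_cartan r A" and P: "P \<in> carrier_mat l r"
  shows "cluster_additive r l A (\<lambda>i m. col (P_mat A P i m) i)"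
proof -
  note cA = sym_gen_cartanD(1)[OF A]
  note col = col_P_mat[OF cA P]
  show ?thesis
    unfolding cluster_additive_iff[OF cA]
    using B_tilde_bottom_recurrence[OF A P] by (simp add: col)
qed

text \<open>The bottom block starts as \<open>P\<close>, and column \<open>j\<close> receives one
  term from each earlier mutation of the round. Solved for \<open>P $$ (x, j)\<close>, this recovers
  \<open>P\<close> from the values at \<open>m = 0\<close>.\<close>

lemma col_P_mat_initial:
  assumes A: "sym_gen_cartan r A" and P: "P \<in> carrier_mat l r" and x: "x < l" and j: "j < r"
  shows "col (P_mat A P j 0) j $ x = P $$ (x, j)
    + (\<Sum>k\<in>{0..<j}. (- A $$ (k, j)) * pos_int (col (P_mat A P k 0) k $ x))"
proof -
  note cA = sym_gen_cartanD(1)[OF A]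
  have "B_tilde A P 0 0 $$ (r + x, j) = P $$ (x, j)"
    using cA P x j by (auto simp: B_tilde_start append_rows_def B_mat_def)
  then show ?thesis
    using B_tilde_bottom_before[OF A P x j order_refl, of 0] j x
    by (simp add: col_P_mat[OF cA P])
qed

theorem proposition5p7:
  fixes r l :: nat and A :: "int mat"
  assumes "sym_gen_cartan r A" and "1 \<le> l"
  shows "(\<forall>P \<in> carrier_mat l r. cluster_additive r l A (\<lambda>i m. col (P_mat A P i m) i)) \<and>
         (\<forall>q. cluster_additive r l A q \<longrightarrow>
            (\<exists>!P. P \<in> carrier_mat l r \<and> (\<forall>i<r. \<forall>m. q i m = col (P_mat A P i m) i)))"
proof (intro conjI ballI allI impI)
  note A = assms(1)
  note cA = sym_gen_cartanD(1)[OF A]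
  show "cluster_additive r l A (\<lambda>i m. col (P_mat A P i m) i)" if "P \<in> carrier_mat l r" for P
    by (rule cluster_additive_P_mat[OF A that])
  fix q assume q: "cluster_additive r l A q"
  \<comment> \<open>This is \<open>col_P_mat_initial\<close> solved for the entry of
    \<open>P\<close>, with the prescribed \<open>q k 0\<close> in place of the columns.\<close>
  define P where "P = mat l r (\<lambda>(x, j). q j 0 $ x
    - (\<Sum>k\<in>{0..<j}. (- A $$ (k, j)) * pos_int (q k 0 $ x)))"
  have P: "P \<in> carrier_mat l r" by (simp add: P_def)
  \<comment> \<open>Strong induction works because the correction sum for column \<open>j\<close>
    involves earlier columns only.\<close>
  have "j < r \<longrightarrow> q j 0 = col (P_mat A P j 0) j" for j
  proof (induction j rule: less_induct)
    case (less j)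
    show ?case
    proof (intro impI eq_vecI)
      assume j: "j < r"
      have dim: "dim_vec (col (P_mat A P j 0) j) = l"
        by (rule carrier_vecD[OF col_P_mat(1)[OF cA P j]])
      show "dim_vec (q j 0) = dim_vec (col (P_mat A P j 0) j)"
        using q j unfolding dim by (auto simp: cluster_additive_def)
      fix x assume "x < dim_vec (col (P_mat A P j 0) j)"
      then have x: "x < l" unfolding dim .
      have "(\<Sum>k\<in>{0..<j}. (- A $$ (k, j)) * pos_int (col (P_mat A P k 0) k $ x))
          = (\<Sum>k\<in>{0..<j}. (- A $$ (k, j)) * pos_int (q k 0 $ x))"
        using less j by (intro sum.cong) auto
      then show "q j 0 $ x = col (P_mat A P j 0) j $ x"
        unfolding col_P_mat_initial[OF A P x j] using x j by (simp add: P_def)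
    qed
  qed
  then have ex: "q i m = col (P_mat A P i m) i" if "i < r" for i m
    using cluster_additive_eqI[OF cA q cluster_additive_P_mat[OF A P] _ that] by blast
  show "\<exists>!P. P \<in> carrier_mat l r \<and> (\<forall>i<r. \<forall>m. q i m = col (P_mat A P i m) i)"
  proof (rule ex1I[of _ P])
    fix P' assume P': "P' \<in> carrier_mat l r \<and> (\<forall>i<r. \<forall>m. q i m = col (P_mat A P' i m) i)"
    show "P' = P"
    proof (rule eq_matI)
      fix x j assume "x < dim_row P" "j < dim_col P"
      then have xj: "x < l" "j < r" using P by auto
      \<comment> \<open>The correction sum depends on \<open>q\<close> alone, so the entry of
        \<open>P'\<close> is forced.\<close>
      have "q j 0 $ x = P' $$ (x, j) + (\<Sum>k\<in>{0..<j}. (- A $$ (k, j)) * pos_int (q k 0 $ x))"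
        using col_P_mat_initial[OF A _ xj, of P'] P' xj by simp
      then show "P' $$ (x, j) = P $$ (x, j)" using xj by (simp add: P_def)
    qed (use P P' in auto)
  qed (use P ex in auto)
qed

end
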